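(* Let $\bar a(x)$ be defined by $(1,xa(x))^{-1}=(1,x\bar a(x))$. Then the polynomials $(-1)^n J_n h_n(x)$ are the numerator polynomials of the exponential Riordan matrix $\left(b(x\bar a(x))\,(x\bar a(x))',\;x\bar a(x)\right)_E$; that is, the generating function of the $n$th descending diagonal of this matrix equals $(-1)^n J_n h_n(x)/(1-x)^{2n+1}$.
   Context: All series are formal power series. A Riordan matrix $(f(x),g(x))$, $g_0=0$, is the infinite lower triangular matrix whose $n$th column has generating function $f(x)g^n(x)$; matrices are multiplied according to $(f(x),g(x))(b(x),a(x))=(f(x)b(g(x)),a(g(x)))$, and $(1,g(x))^{-1}$ denotes the inverse in this group. The exponential Riordan matrix is $(f(x),g(x))_E=|e^x|^{-1}(f(x),g(x))|e^x|$, where $|e^x|$ is the diagonal matrix with $|e^x|x^n=x^n/n!$. Let $b(x),a(x)$ be series with $b_0\neq 0$, $a_0=1$. Let $s_n(x)$ be the $n$th row polynomial of $(b(x),\log a(x))_E$, so that $b(x)a^m(x)=\sum_{n\ge0}\frac{s_n(m)}{n!}x^n$. Write $[\varphi]_n=\varphi(\varphi+1)\cdots(\varphi+n-1)$ for the ascending factorial. The generalized Narayana polynomial $h_n(x)$ (a polynomial of degree $\le n$) is defined by: the $n$th descending diagonal of $(b(x),xa(x))_E$ has generating function $\sum_{m\ge0}\frac{[m+1]_n s_n(m)}{n!}x^m=\frac{h_n(x)}{(1-x)^{2n+1}}$. $J_n$ is the operator reversing the coefficients of a polynomial of degree $\le n$: $J_n c(x)=x^n c(1/x)$. The $n$th numerator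 polynomial of an exponential Riordan matrix is the polynomial $P_n(x)$ such that its $n$th descending diagonal has generating function $P_n(x)/(1-x)^{2n+1}$. *)

theory Defs
  imports "HOL-Computational_Algebra.Computational_Algebra"
begin

unbundle fps_syntax

text \<open>
  Infinite matrices are functions of the row index and the column index, both starting at 0.
  Coefficients lie in an arbitrary field of characteristic 0.
\<close>

type_synonym 'a inf_mat = "nat \<Rightarrow> nat \<Rightarrow> 'a"

text \<open>
  All matrices below are lower triangular, so that the entries of the left factor in row \<open>n\<close>
  vanish beyond column \<open>n\<close> and the finite sum is the full matrix product.
\<close>

definition lt_mult :: "'a::comm_ring_1 inf_mat \<Rightarrow> 'a inf_mat \<Rightarrow> 'a inf_mat" where
  "lt_mult A B = (\<lambda>n m. \<Sum>k\<le>n. A n k * B k m)"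

definition diag_mat :: "(nat \<Rightarrow> 'a::comm_ring_1) \<Rightarrow> 'a inf_mat" where
  "diag_mat d = (\<lambda>n m. if n = m then d n else 0)"

definition lt_inverse :: "'a::comm_ring_1 inf_mat \<Rightarrow> 'a inf_mat \<Rightarrow> bool" where
  "lt_inverse A B \<longleftrightarrow> lt_mult A B = diag_mat (\<lambda>_. 1) \<and> lt_mult B A = diag_mat (\<lambda>_. 1)"

definition riordan :: "'a::comm_ring_1 fps \<Rightarrow> 'a fps \<Rightarrow> 'a inf_mat" where
  "riordan f g = (\<lambda>n m. (f * g ^ m) $ n)"

text \<open>
  The conjugate of \<open>riordan f g\<close> by the diagonal matrix with the coefficients \<open>1 / n!\<close>
  of the exponential series.
\<close>

definition exp_riordan :: "'a::field_char_0 fps \<Rightarrow> 'a fps \<Rightarrow> 'a inf_mat" where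
  "exp_riordan f g =
     lt_mult (lt_mult (diag_mat (\<lambda>n. inverse (fps_exp 1 $ n))) (riordan f g))
             (diag_mat (\<lambda>n. fps_exp 1 $ n))"

text \<open>The main diagonal is the \<open>0\<close>th descending diagonal.\<close>

definition diagonal_gf :: "'a::comm_ring_1 inf_mat \<Rightarrow> nat \<Rightarrow> 'a fps" where
  "diagonal_gf M n = Abs_fps (\<lambda>m. M (m + n) m)"

definition row_poly :: "'a::comm_ring_1 inf_mat \<Rightarrow> nat \<Rightarrow> 'a poly" where
  "row_poly M n = (\<Sum>k\<le>n. monom (M n k) k)"

text \<open>\<open>fps_ln 1\<close> is the series of \<open>log (1 + x)\<close>; the definition is meant for \<open>a $ 0 = 1\<close>.\<close>

definition fps_log :: "'a::field_char_0 fps \<Rightarrow> 'a fps" where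
  "fps_log a = fps_ln 1 oo (a - 1)"

definition s_poly :: "'a::field_char_0 fps \<Rightarrow> 'a fps \<Rightarrow> nat \<Rightarrow> 'a poly" where
  "s_poly b a n = row_poly (exp_riordan b (fps_log a)) n"

definition is_numerator_poly :: "'a::field_char_0 inf_mat \<Rightarrow> nat \<Rightarrow> 'a poly \<Rightarrow> bool" where
  "is_numerator_poly M n P \<longleftrightarrow>
     diagonal_gf M n = fps_of_poly P / (1 - fps_X) ^ (2 * n + 1)"

definition narayana_poly :: "'a::field_char_0 fps \<Rightarrow> 'a fps \<Rightarrow> nat \<Rightarrow> 'a poly" where
  "narayana_poly b a n =
     (THE h. degree h \<le> n \<and>
        Abs_fps (\<lambda>m. pochhammer (of_nat m + 1) n * poly (s_poly b a n) (of_nat m) / fact n)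
          = fps_of_poly h / (1 - fps_X) ^ (2 * n + 1))"

text \<open>
  \<open>x\<^sup>n c (1/x)\<close> for a polynomial \<open>c\<close> of degree at most \<open>n\<close>.  Unlike
  \<^const>\<open>reflect_poly\<close> the reversal is with respect to \<open>n\<close>, not to the degree of \<open>c\<close>.
\<close>

definition rev_poly :: "nat \<Rightarrow> 'a::comm_ring_1 poly \<Rightarrow> 'a poly" where
  "rev_poly n c = (\<Sum>i\<le>n. monom (coeff c (n - i)) i)"


lemma riordan_one_X: "riordan 1 fps_X = diag_mat (\<lambda>_. 1)"
  by (auto simp: riordan_def diag_mat_def fun_eq_iff)

lemma riordan_mult:
  fixes f g b a :: "'a::field_char_0 fps"
  assumes "g $ 0 = 0"
  shows "lt_mult (riordan f g) (riordan b a) = riordan (f * (b oo g)) (a oo g)"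
proof (intro ext)
  fix n m
  have *: "(f * (c oo g)) $ n = (\<Sum>k\<le>n. (f * g ^ k) $ n * c $ k)" for c
  proof -
    have "(f * (c oo g)) $ n = (\<Sum>i\<le>n. f $ i * (\<Sum>k\<le>n - i. c $ k * (g ^ k) $ (n - i)))"
      by (simp add: fps_mult_nth fps_compose_nth atLeast0AtMost)
    also have "\<dots> = (\<Sum>i\<le>n. f $ i * (\<Sum>k\<le>n. c $ k * (g ^ k) $ (n - i)))"
    proof (rule sum.cong[OF refl])
      fix i
      have "(\<Sum>k\<le>n - i. c $ k * (g ^ k) $ (n - i)) = (\<Sum>k\<le>n. c $ k * (g ^ k) $ (n - i))"
        by (rule sum.mono_neutral_left)
          (use startsby_zero_power_prefix[OF assms] in auto)
      then show "f $ i * (\<Sum>k\<le>n - i. c $ k * (g ^ k) $ (n - i))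
          = f $ i * (\<Sum>k\<le>n. c $ k * (g ^ k) $ (n - i))"
        by simp
    qed
    also have "\<dots> = (\<Sum>k\<le>n. (\<Sum>i\<le>n. f $ i * (g ^ k) $ (n - i)) * c $ k)"
      unfolding sum_distrib_left sum_distrib_right
      by (subst sum.swap) (simp add: mult_ac)
    finally show ?thesis
      by (simp add: fps_mult_nth atLeast0AtMost)
  qed
  have "(b * a ^ m) oo g = (b oo g) * (a oo g) ^ m"
    using assms by (simp add: fps_compose_mult_distrib fps_compose_power)
  then show "lt_mult (riordan f g) (riordan b a) n m = riordan (f * (b oo g)) (a oo g) n m"
    using *[of "b * a ^ m"] by (simp add: lt_mult_def riordan_def mult.assoc)
qed

lemma riordan_inverse_iff:
  fixes a c :: "'a::field_char_0 fps"
  assumes "a $ 0 = 1"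
  shows "lt_inverse (riordan 1 (fps_X * a)) (riordan 1 (fps_X * c))
           \<longleftrightarrow> fps_X * c = fps_inv (fps_X * a)"
proof -
  let ?g = "fps_X * a"
  have g: "?g $ 0 = 0" "?g $ 1 \<noteq> 0"
    using assms by simp_all
  have eq: "riordan 1 f = diag_mat (\<lambda>_. 1) \<longleftrightarrow> f = fps_X" for f :: "'a fps"
  proof
    assume "riordan 1 f = diag_mat (\<lambda>_. 1)"
    then have "riordan 1 f n 1 = diag_mat (\<lambda>_. 1) n 1" for n
      by simp
    then show "f = fps_X"
      by (auto simp: riordan_def diag_mat_def fps_eq_iff split: if_splits)
  qed (simp add: riordan_one_X)
  have "lt_inverse (riordan 1 ?g) (riordan 1 (fps_X * c))
          \<longleftrightarrow> (fps_X * c) oo ?g = fps_X \<and> ?g oo (fps_X * c) = fps_X"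
    by (simp add: lt_inverse_def riordan_mult eq)
  also have "\<dots> \<longleftrightarrow> fps_X * c = fps_inv ?g"
    using fps_inv[OF g] fps_inv_right[OF g] fps_compose_inj_right[OF g] by metis
  finally show ?thesis .
qed

lemma riordan_inverse_ex1:
  fixes a :: "'a::field_char_0 fps"
  assumes "a $ 0 = 1"
  shows "\<exists>!c. lt_inverse (riordan 1 (fps_X * a)) (riordan 1 (fps_X * c))"
proof -
  have "fps_inv (fps_X * a) $ 0 = 0"
    by (simp add: fps_inv_def)
  then have "fps_X * fps_shift 1 (fps_inv (fps_X * a)) = fps_inv (fps_X * a)"
    by (auto simp: fps_eq_iff)
  then show ?thesis
    unfolding riordan_inverse_iff[OF assms] by (metis fps_X_neq_zero mult_left_cancel)
qed

lemma exp_riordan_nth: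
  "exp_riordan f g n m = fact n / fact m * (f * g ^ m) $ n" if "m \<le> n"
  using that
  by (simp add: exp_riordan_def lt_mult_def diag_mat_def riordan_def
      if_distrib if_distribR sum.delta sum.delta' cong: if_cong)

lemma is_numerator_poly_unique:
  assumes "is_numerator_poly M n P" "is_numerator_poly M n Q"
  shows "P = Q"
proof -
  have "((1 - fps_X) ^ (2 * n + 1) :: 'a fps) $ 0 \<noteq> 0"
    by (simp add: fps_power_zeroth)
  then have "is_unit ((1 - fps_X) ^ (2 * n + 1) :: 'a fps)"
    by (simp only: fps_is_unit_iff not_False_eq_True)
  then have "fps_of_poly P = fps_of_poly Q"
    using assms unfolding is_numerator_poly_def by (metis unit_div_cancel)
  then show ?thesis
    by (simp add: fps_of_poly_eq_iff)
qed

lemma s_poly_gf: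
  fixes a b :: "'a::field_char_0 fps"
  assumes "a $ 0 = 1"
  shows "b * a ^ m = Abs_fps (\<lambda>n. poly (s_poly b a n) (of_nat m) / fact n)"
proof -
  let ?l = "fps_log a"
  have l0: "?l $ 0 = 0"
    by (simp add: fps_log_def)
  have "(fps_exp 1 - 1) oo ?l = ((fps_exp 1 - 1) oo fps_ln 1) oo (a - 1)"
    unfolding fps_log_def by (rule fps_compose_assoc) (use assms in simp_all)
  also have "\<dots> = fps_X oo (a - 1)"
    using fps_inv_fps_exp_compose(2)[of "1::'a"] by (simp add: fps_ln_fps_exp_inv)
  also have "\<dots> = a - 1"
    using assms by simp
  finally have "fps_exp 1 oo ?l = a"
    by (simp add: fps_compose_sub_distrib)
  then have am: "a ^ m = fps_exp (of_nat m) oo ?l"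
    using fps_compose_power[OF l0, of "fps_exp 1" m] by (simp add: fps_exp_power_mult)
  have "(b * a ^ m) $ n = poly (s_poly b a n) (of_nat m) / fact n" for n
  proof -
    have "(b * a ^ m) $ n = riordan (b * (fps_exp (of_nat m) oo ?l)) (1 oo ?l) n 0"
      by (simp add: riordan_def am)
    also have "\<dots> = lt_mult (riordan b ?l) (riordan (fps_exp (of_nat m)) 1) n 0"
      by (simp add: riordan_mult[OF l0])
    also have "\<dots> = (\<Sum>k\<le>n. (b * ?l ^ k) $ n * (of_nat m ^ k / fact k))"
      by (simp add: lt_mult_def riordan_def)
    also have "\<dots> = poly (s_poly b a n) (of_nat m) / fact n"
      by (simp add: s_poly_def row_poly_def poly_sum poly_monom exp_riordan_nth
          sum_divide_distrib mult_ac)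
    finally show ?thesis .
  qed
  then show ?thesis
    by (simp add: fps_eq_iff)
qed

lemma diagonal_gf_s_poly:
  fixes a b :: "'a::field_char_0 fps"
  assumes "a $ 0 = 1"
  shows "diagonal_gf (exp_riordan b (fps_X * a)) n =
    Abs_fps (\<lambda>m. pochhammer (of_nat m + 1) n * poly (s_poly b a n) (of_nat m) / fact n)"
proof -
  have "exp_riordan b (fps_X * a) (m + n) m =
      pochhammer (of_nat m + 1) n * poly (s_poly b a n) (of_nat m) / fact n" for m
  proof -
    have "b * (fps_X * a) ^ m = fps_X ^ m * (b * a ^ m)"
      by (simp add: power_mult_distrib mult_ac)
    then have "(b * (fps_X * a) ^ m) $ (m + n) = poly (s_poly b a n) (of_nat m) / fact n"
      by (simp add: fps_X_power_mult_nth s_poly_gf[OF assms])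
    moreover have "(fact (m + n) :: 'a) = fact m * pochhammer (of_nat m + 1) n"
      by (simp add: pochhammer_fact pochhammer_product'[of 1 m n] add.commute)
    ultimately show ?thesis
      by (simp add: exp_riordan_nth)
  qed
  then show ?thesis
    by (simp add: diagonal_gf_def)
qed

end

theory Submission
  imports Defs
begin

text \<open>
  Let \<open>p(m) = [m+1]\<^sub>n s\<^sub>n(m) / n!\<close>, a polynomial in \<open>m\<close> of degree at most \<open>2n\<close> that vanishes at
  \<open>m = -1, \<dots>, -n\<close>.  By reciprocity for generating functions of polynomial sequences,
  \<open>\<Sum> p(m) x\<^sup>m = h\<^sub>n(x) / (1-x)\<^bsup>2n+1\<^esup>\<close> implies
  \<open>\<Sum> p(-m-n-1) x\<^sup>m = J\<^sub>n h\<^sub>n(x) / (1-x)\<^bsup>2n+1\<^esup>\<close>.  On the other hand, Lagrange inversion in the form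
  \<open>[x\<^sup>N] c(g(x)) g'(x) = [x\<^sup>N] c(x) a(x)\<^bsup>-N-1\<^esup>\<close>, where \<open>g\<close> is the compositional inverse of
  \<open>x a(x)\<close>, shows that the entry of \<open>(b(g(x)) g'(x), g(x))\<^sub>E\<close> in row \<open>m+n\<close> and column \<open>m\<close> is
  \<open>(-1)\<^sup>n p(-m-n-1)\<close>.
\<close>

subsection \<open>Lagrange inversion\<close>

text \<open>With g = x u, the coefficient is the residue of g' / g^(j+1). For j > 0 that quotient is
  the derivative of -g^(-j) / j and has no residue; for j = 0 the logarithmic derivative g'/g has
  residue 1. To stay within power series, the proof differentiates u^(-j) and cancels the factor
  j.\<close>

lemma fps_deriv_X_times_inverse_power_nth:
  fixes u :: "'a::field_char_0 fps"
  assumes "u $ 0 \<noteq> 0"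
  shows "(fps_deriv (fps_X * u) * inverse u ^ Suc j) $ j = (if j = 0 then 1 else 0)"
proof (cases j)
  case 0
  then show ?thesis using assms by (simp add: fps_mult_nth)
next
  case (Suc i)
  let ?v = "inverse u"
  have uv: "u * ?v = 1"
    using assms by (simp add: inverse_mult_eq_1')
  have deriv_v: "fps_deriv ?v = - fps_deriv u * ?v ^ 2"
    using assms by (simp add: fps_inverse_deriv)
  have "fps_deriv (?v ^ Suc i)
      = fps_const (of_nat (Suc i)) * - (fps_deriv u * ?v ^ Suc (Suc i))"
    by (simp only: fps_deriv_power deriv_v diff_Suc_1)
      (simp add: power2_eq_square mult_ac del: of_nat_Suc)
  moreover have "fps_deriv (?v ^ Suc i) $ i = of_nat (Suc i) * (?v ^ Suc i) $ Suc i"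
    by (simp only: fps_deriv_nth Suc_eq_plus1)
  ultimately have "of_nat (Suc i) * - ((fps_deriv u * ?v ^ Suc (Suc i)) $ i)
      = of_nat (Suc i) * (?v ^ Suc i) $ Suc i"
    by (metis fps_mult_left_const_nth fps_neg_nth)
  then have "- ((fps_deriv u * ?v ^ Suc (Suc i)) $ i) = (?v ^ Suc i) $ Suc i"
    by (simp only: mult_cancel_left of_nat_eq_0_iff) simp
  then have *: "(fps_deriv u * ?v ^ Suc (Suc i)) $ i + (?v ^ Suc i) $ Suc i = 0"
    by (metis add.right_inverse)
  have "fps_deriv (fps_X * u) * ?v ^ Suc j
      = (u * ?v) * ?v ^ Suc i + fps_X * (fps_deriv u * ?v ^ Suc (Suc i))"
    by (simp add: Suc algebra_simps)
  then have "(fps_deriv (fps_X * u) * ?v ^ Suc j) $ j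
      = (?v ^ Suc i + fps_X * (fps_deriv u * ?v ^ Suc (Suc i))) $ j"
    by (simp only: uv mult_1_left)
  also have "\<dots> = 0"
    using * by (simp add: Suc fps_X_mult_nth add.commute del: power_Suc)
  finally show ?thesis by (simp add: Suc)
qed

lemma lagrange_inversion_compose:
  fixes a c u :: "'a::field_char_0 fps"
  assumes a: "a $ 0 = 1" and u: "fps_X * u = fps_inv (fps_X * a)"
  shows "((c oo (fps_X * u)) * fps_deriv (fps_X * u)) $ N = (c * inverse a ^ Suc N) $ N"
proof -
  let ?g = "fps_X * u"
  have g0: "?g $ 0 = 0" by simp
  have "fps_X * a oo ?g = fps_X"
    unfolding u by (rule fps_inv_right) (use a in simp_all)
  then have "fps_X * (u * (a oo ?g)) = fps_X * 1"
    by (simp add: fps_compose_mult_distrib[OF g0] mult.assoc)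
  then have ua: "u * (a oo ?g) = 1"
    by (subst (asm) mult_left_cancel) simp_all
  then have u0: "u $ 0 \<noteq> 0"
    by (metis fps_mult_nth_0 mult_zero_left one_neq_zero fps_one_nth)
  \<comment> \<open>Since a(g) = 1/u, composing \<open>?e\<close> with g gives c(g) u^(N+1), and the
    factor u^(-N-1) in \<open>?w\<close> cancels that power. Thus c(g) g' = \<open>?w\<close> *
    (\<open>?e\<close> oo g).\<close>
  let ?w = "fps_deriv ?g * inverse u ^ Suc N"
  let ?e = "c * inverse a ^ Suc N"
  have "inverse a oo ?g = u"
  proof -
    have "inverse a oo ?g = inverse (a oo ?g)"
      using a by (simp add: fps_inverse_compose)
    also have "\<dots> = u"
      using ua by (metis fps_inverse_unique mult.commute)
    finally show ?thesis .
  qed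
  then have "?e oo ?g = (c oo ?g) * u ^ Suc N"
    by (simp only: fps_compose_mult_distrib[OF g0] fps_compose_power[OF g0, symmetric])
  then have "?w * (?e oo ?g) = (c oo ?g) * fps_deriv ?g * (u * inverse u) ^ Suc N"
    by (simp only: power_mult_distrib mult_ac)
  then have "((c oo ?g) * fps_deriv ?g) $ N = (?w * (?e oo ?g)) $ N"
    by (simp only: inverse_mult_eq_1'[OF u0] power_one mult_1_right)
  \<comment> \<open>Column 0 of a Riordan product expands \<open>?e\<close> oo g in powers of g as a
    finite sum; the residue lemma, with j = N - k, keeps only the term k = N.\<close>
  also have "\<dots> = riordan (?w * (?e oo ?g)) (1 oo ?g) N 0"
    by (simp only: riordan_def power_0 mult_1_right)
  also have "\<dots> = lt_mult (riordan ?w ?g) (riordan ?e 1) N 0"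
    by (simp only: riordan_mult[OF g0])
  also have "\<dots> = (\<Sum>k\<le>N. (?w * ?g ^ k) $ N * ?e $ k)"
    by (simp only: lt_mult_def riordan_def power_0 mult_1_right)
  also have "\<dots> = (\<Sum>k\<le>N. if k = N then ?e $ N else 0)"
  proof (rule sum.cong[OF refl])
    fix k assume "k \<in> {..N}"
    then have k: "k \<le> N" by simp
    have "inverse u ^ Suc N * u ^ k = inverse u ^ Suc (N - k) * (u * inverse u) ^ k"
    proof -
      have "inverse u ^ Suc N = inverse u ^ Suc (N - k) * inverse u ^ k"
        using k by (simp flip: power_add)
      then show ?thesis by (simp only: power_mult_distrib mult_ac)
    qed
    also have "\<dots> = inverse u ^ Suc (N - k)"
      using u0 by (simp add: inverse_mult_eq_1')
    finally have "?w * ?g ^ k = fps_X ^ k * (fps_deriv ?g * inverse u ^ Suc (N - k))"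
      by (simp only: power_mult_distrib mult_ac)
    then have "(?w * ?g ^ k) $ N = (fps_deriv ?g * inverse u ^ Suc (N - k)) $ (N - k)"
      using k by (simp only: fps_X_power_mult_nth) simp
    then show "(?w * ?g ^ k) $ N * ?e $ k = (if k = N then ?e $ N else 0)"
      using k by (simp only: fps_deriv_X_times_inverse_power_nth[OF u0]) auto
  qed
  also have "\<dots> = ?e $ N" by simp
  finally show ?thesis .
qed

subsection \<open>Reciprocity for polynomial sequences\<close>

text \<open>The shift by 1 preserves the leading coefficient, so it cancels in the forward
  difference.\<close>

lemma degree_pcompose_shift_diff_less:
  fixes p :: "'a::idom poly"
  assumes "degree p > 0"
  shows "degree (pcompose p [:1, 1:] - p) < degree p"
proof (cases "pcompose p [:1, 1:] - p = 0")
  case False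
  have deg: "degree (pcompose p [:1, 1:]) = degree p"
    by (simp add: degree_pcompose)
  have "degree (pcompose p [:1, 1:] - p) \<le> degree p"
    using deg by (intro degree_diff_le) simp_all
  moreover have "coeff (pcompose p [:1, 1:]) (degree p) = lead_coeff p"
    using lead_coeff_comp[of "[:1, 1:]" p] deg by simp
  then have "coeff (pcompose p [:1, 1:] - p) (degree p) = 0" by simp
  ultimately show ?thesis
    using False by (metis le_neq_implies_less leading_coeff_0_iff)
qed (use assms in simp)

text \<open>Up to sign this is the d-th forward difference of p at x. Pascal's rule trades one order
  of the sum for one difference of p, which lowers the degree.\<close>

lemma alternating_binomial_sum_poly_eq_0:
  fixes p :: "'a::idom poly"
  assumes "degree p < d"
  shows "(\<Sum>j\<le>d. (-1) ^ j * of_nat (d choose j) * poly p (x + of_nat j)) = 0"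
  using assms
proof (induction d arbitrary: p)
  case (Suc d)
  let ?T = "\<lambda>q d. \<Sum>j\<le>d. (-1) ^ j * of_nat (d choose j) * poly q (x + of_nat j)"
  let ?q = "pcompose p [:1, 1:]"
  have "?T p (Suc d) = poly p x +
      (\<Sum>j\<le>d. (-1) ^ Suc j * of_nat (Suc d choose Suc j) * poly p (x + of_nat (Suc j)))"
    by (subst sum.atMost_Suc_shift) simp
  also have "\<dots> = poly p x +
      (\<Sum>j\<le>d. (-1) ^ Suc j * of_nat (d choose Suc j) * poly p (x + of_nat (Suc j))) - ?T ?q d"
    by (simp add: poly_pcompose algebra_simps sum.distrib sum_negf sum_subtractf)
  also have "poly p x +
      (\<Sum>j\<le>d. (-1) ^ Suc j * of_nat (d choose Suc j) * poly p (x + of_nat (Suc j)))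
      = (\<Sum>j\<le>Suc d. (-1) ^ j * of_nat (d choose j) * poly p (x + of_nat j))"
    by (subst sum.atMost_Suc_shift) simp
  also have "\<dots> = ?T p d" by (simp add: binomial_eq_0)
  finally have rec: "?T p (Suc d) = - ?T (?q - p) d"
    by (simp add: algebra_simps sum_subtractf)
  \<comment> \<open>Constants are treated apart: their difference is 0, but its degree is not below
    d when d = 0.\<close>
  show ?case
  proof (cases "degree p = 0")
    case True
    then obtain k where "p = [:k:]" by (metis degree_eq_zeroE)
    then have "?q - p = 0" by simp
    then show ?thesis unfolding rec by simp
  next
    case False
    then have "degree (?q - p) < d"
      using degree_pcompose_shift_diff_less[of p] Suc.prems by linarith
    then show ?thesis unfolding rec by (simp only: Suc.IH minus_zero)
  qed
qed simp

lemma one_minus_fps_X_power_nth: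
  "((1 - fps_X :: 'a::comm_ring_1 fps) ^ d) $ j = (-1) ^ j * of_nat (d choose j)"
proof (induction d arbitrary: j)
  case (Suc d)
  then show ?case
    by (cases j) (simp_all add: left_diff_distrib algebra_simps)
next
  case 0
  then show ?case by (cases j) simp_all
qed

lemma Abs_fps_mult_one_minus_fps_X_power_nth:
  fixes f :: "nat \<Rightarrow> 'a::comm_ring_1"
  shows "(Abs_fps f * (1 - fps_X) ^ d) $ k = (\<Sum>j\<le>k. (-1) ^ j * of_nat (d choose j) * f (k - j))"
  by (simp add: mult.commute[of "Abs_fps f"] fps_mult_nth one_minus_fps_X_power_nth atLeast0AtMost)

lemma coeff_rev_poly: "coeff (rev_poly n c) k = (if k \<le> n then coeff c (n - k) else 0)"
  by (simp add: rev_poly_def coeff_sum)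

text \<open>Each coefficient of either product is a truncated alternating binomial sum of order
  2n+1, and the full sum vanishes because p has degree at most 2n. The n consecutive zeros of p fill
  the gap between a truncated sum and its complement.\<close>

lemma poly_sequence_gf_reciprocity:
  fixes p :: "'a::field_char_0 poly"
  assumes deg: "degree p \<le> 2 * n"
    and zero: "\<And>i. 1 \<le> i \<Longrightarrow> i \<le> n \<Longrightarrow> poly p (- of_nat i) = 0"
  obtains h where "degree h \<le> n"
    and "Abs_fps (\<lambda>m. poly p (of_nat m)) * (1 - fps_X) ^ (2 * n + 1) = fps_of_poly h"
    and "Abs_fps (\<lambda>m. poly p (- of_nat (m + n + 1))) * (1 - fps_X) ^ (2 * n + 1)
           = fps_of_poly (rev_poly n h)"
proof -
  let ?d = "2 * n + 1"
  define B :: "nat \<Rightarrow> 'a" where "B j = (-1) ^ j * of_nat (?d choose j)" for j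
  let ?F = "Abs_fps (\<lambda>m. poly p (of_nat m)) * (1 - fps_X) ^ ?d"
  let ?G = "Abs_fps (\<lambda>m. poly p (- of_nat (m + n + 1))) * (1 - fps_X) ^ ?d"
  have B0: "j \<le> ?d" if "B j \<noteq> 0" for j
    using that by (auto simp: B_def binomial_eq_0_iff not_less)
  \<comment> \<open>The sign appears because 2n+1 is odd.\<close>
  have Brev: "B (?d - j) = - B j" if "j \<le> ?d" for j
  proof -
    have "(-1 :: 'a) ^ (?d - j) * (-1) ^ j = - 1"
      using that by (simp flip: power_add)
    then have "(-1 :: 'a) ^ (?d - j) = - ((-1) ^ j)"
      by (metis (no_types, opaque_lifting) left_minus_one_mult_self mult.commute mult_minus1_right)
    then show ?thesis
      using binomial_symmetric[OF that] by (simp add: B_def)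
  qed
  have full: "(\<Sum>j\<le>?d. B j * poly p (x + of_nat j)) = 0" for x
    unfolding B_def by (rule alternating_binomial_sum_poly_eq_0) (use deg in simp)
  have F_rev: "?F $ k = (\<Sum>j\<le>k. B j * poly p (of_nat k - of_nat j))" for k
    unfolding Abs_fps_mult_one_minus_fps_X_power_nth B_def
    by (intro sum.cong refl) (simp add: of_nat_diff)
  have G: "?G $ k = (\<Sum>j\<le>k. B j * poly p (- of_nat (k + n + 1) + of_nat j))" for k
    unfolding Abs_fps_mult_one_minus_fps_X_power_nth B_def
    by (intro sum.cong refl) (simp add: of_nat_diff algebra_simps)
  \<comment> \<open>Reversing j to 2n+1-j turns an initial segment of the sum into a final one, with
    arguments increasing in j.\<close>
  have F: "?F $ k = - (\<Sum>j\<in>{j. j \<le> ?d \<and> ?d \<le> k + j}. B j * poly p (of_nat k - of_nat ?d + of_nat j))" for k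
  proof -
    have "?F $ k = (\<Sum>j\<in>{j. j \<le> ?d \<and> j \<le> k}. B j * poly p (of_nat k - of_nat j))"
      unfolding F_rev by (rule sum.mono_neutral_right) (auto dest!: B0)
    also have "\<dots> = (\<Sum>j\<in>{j. j \<le> ?d \<and> ?d \<le> k + j}. B (?d - j) * poly p (of_nat k - of_nat (?d - j)))"
      by (rule sum.reindex_bij_witness[where i = "\<lambda>j. ?d - j" and j = "\<lambda>j. ?d - j"]) auto
    also have "\<dots> = (\<Sum>j\<in>{j. j \<le> ?d \<and> ?d \<le> k + j}. - (B j * poly p (of_nat k - of_nat ?d + of_nat j)))"
    proof (rule sum.cong[OF refl])
      fix j assume "j \<in> {j. j \<le> ?d \<and> ?d \<le> k + j}"
      then have j: "j \<le> ?d" by simp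
      then have "of_nat k - of_nat (?d - j) = (of_nat k - of_nat ?d + of_nat j :: 'a)"
        by (simp only: of_nat_diff) simp
      then show "B (?d - j) * poly p (of_nat k - of_nat (?d - j))
          = - (B j * poly p (of_nat k - of_nat ?d + of_nat j))"
        by (simp only: Brev[OF j] mult_minus_left)
    qed
    finally show ?thesis by (simp only: sum_negf)
  qed
  \<comment> \<open>For k > n the terms missing from the full sum have arguments between -n and -1,
    which are zeros of p.\<close>
  have F0: "?F $ k = 0" if "k > n" for k
  proof -
    have "(\<Sum>j\<in>{j. j \<le> ?d \<and> ?d \<le> k + j}. B j * poly p (of_nat k - of_nat ?d + of_nat j))
        = (\<Sum>j\<le>?d. B j * poly p (of_nat k - of_nat ?d + of_nat j))"
    proof (rule sum.mono_neutral_left)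
      show "\<forall>j\<in>{..?d} - {j. j \<le> ?d \<and> ?d \<le> k + j}. B j * poly p (of_nat k - of_nat ?d + of_nat j) = 0"
      proof
        fix j assume "j \<in> {..?d} - {j. j \<le> ?d \<and> ?d \<le> k + j}"
        then have j: "k + j < ?d" by auto
        then have "of_nat k - of_nat ?d + of_nat j = (- of_nat (?d - k - j) :: 'a)"
          by (simp add: of_nat_diff)
        then show "B j * poly p (of_nat k - of_nat ?d + of_nat j) = 0"
          using zero[of "?d - k - j"] j that by (simp only:) simp
      qed
    qed auto
    then show ?thesis by (simp only: F full minus_zero)
  qed
  \<comment> \<open>The terms with k < j \<le> k+n vanish, so the initial segment is minus the
    segment j > k+n. As k+n+1 = (2n+1) - (n-k), this is the form of \<open>?F $ (n - k)\<close>
    found in \<open>F\<close>; for k > n the segment is empty.\<close>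
  have G0: "?G $ k = (if k \<le> n then ?F $ (n - k) else 0)" for k
  proof -
    let ?t = "\<lambda>j. B j * poly p (- of_nat (k + n + 1) + of_nat j)"
    have van: "?t j = 0" if "k < j" "j \<le> k + n" for j
    proof -
      have "- of_nat (k + n + 1) + of_nat j = (- of_nat (k + n + 1 - j) :: 'a)"
        using that by (simp add: of_nat_diff)
      then show ?thesis
        using zero[of "k + n + 1 - j"] that by (simp only:) simp
    qed
    let ?S = "{j. j \<le> ?d \<and> k + n < j}"
    have "sum ?t {..k} = sum ?t {j. j \<le> ?d \<and> j \<le> k}"
      by (rule sum.mono_neutral_right) (auto dest!: B0)
    then have "sum ?t {..k} + sum ?t ?S = sum ?t {j. j \<le> ?d \<and> j \<le> k} + sum ?t ?S"
      by (simp only:)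
    also have "\<dots> = sum ?t ({j. j \<le> ?d \<and> j \<le> k} \<union> ?S)"
      by (rule sum.union_disjoint[symmetric]) auto
    also have "\<dots> = sum ?t {..?d}"
    proof (rule sum.mono_neutral_left)
      show "\<forall>j\<in>{..?d} - ({j. j \<le> ?d \<and> j \<le> k} \<union> ?S). ?t j = 0"
        by (intro ballI van) auto
    qed auto
    also have "\<dots> = 0" by (rule full)
    finally have *: "?G $ k = - sum ?t ?S"
      unfolding G by (simp only: eq_neg_iff_add_eq_0)
    show ?thesis
    proof (cases "k \<le> n")
      case True
      then have "?S = {j. j \<le> ?d \<and> ?d \<le> n - k + j}" by auto
      moreover have "of_nat (n - k) - of_nat ?d = (- of_nat (k + n + 1) :: 'a)"
        using True by (simp add: of_nat_diff)
      ultimately have "?F $ (n - k) = - sum ?t ?S" by (simp only: F)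
      then show ?thesis using * True by simp
    next
      case False
      then have S: "?S = {}" by auto
      show ?thesis unfolding * S using False by simp
    qed
  qed
  define h where "h = (\<Sum>i\<le>n. monom (?F $ i) i)"
  have h: "coeff h i = (if i \<le> n then ?F $ i else 0)" for i
    by (simp add: h_def coeff_sum)
  have "degree h \<le> n"
    by (rule degree_le) (simp add: h)
  moreover have "?F = fps_of_poly h"
    by (rule fps_ext) (metis F0 fps_of_poly_nth h not_le)
  moreover have "coeff (rev_poly n h) k = (if k \<le> n then ?F $ (n - k) else 0)" for k
    unfolding coeff_rev_poly h by simp
  then have "?G = fps_of_poly (rev_poly n h)"
    by (intro fps_ext) (simp only: G0 fps_of_poly_nth)
  ultimately show ?thesis by (rule that)
qed

subsection \<open>Negative arguments of the row polynomials\<close>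

text \<open>Here e^(c log a) plays the role of a^c, which extends the generating function of s_n(m)
  from natural m to any scalar c, in particular to negative integers.\<close>

lemma fps_compose_fps_log_gf:
  fixes a b :: "'a::field_char_0 fps"
  shows "b * (fps_exp c oo fps_log a) = Abs_fps (\<lambda>n. poly (s_poly b a n) c / fact n)"
proof (rule fps_ext)
  fix n
  let ?l = "fps_log a"
  have l0: "?l $ 0 = 0"
    by (simp add: fps_log_def)
  have "(b * (fps_exp c oo ?l)) $ n = riordan (b * (fps_exp c oo ?l)) (1 oo ?l) n 0"
    by (simp add: riordan_def)
  also have "\<dots> = lt_mult (riordan b ?l) (riordan (fps_exp c) 1) n 0"
    by (simp only: riordan_mult[OF l0])
  also have "\<dots> = (\<Sum>k\<le>n. (b * ?l ^ k) $ n * (c ^ k / fact k))"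
    by (simp add: lt_mult_def riordan_def)
  also have "\<dots> = poly (s_poly b a n) c / fact n"
    by (simp add: s_poly_def row_poly_def poly_sum poly_monom exp_riordan_nth
        sum_divide_distrib mult_ac)
  finally show "(b * (fps_exp c oo ?l)) $ n = Abs_fps (\<lambda>n. poly (s_poly b a n) c / fact n) $ n"
    by simp
qed

lemma fps_exp_compose_fps_log:
  fixes a :: "'a::field_char_0 fps"
  assumes "a $ 0 = 1"
  shows "fps_exp 1 oo fps_log a = a"
proof -
  have "fps_exp 1 oo fps_log a = Abs_fps (\<lambda>n. poly (s_poly 1 a n) 1 / fact n)"
    using fps_compose_fps_log_gf[of 1 1 a] by simp
  also have "\<dots> = a"
    using s_poly_gf[OF assms, of 1 1] by simp
  finally show ?thesis .
qed

lemma s_poly_gf_neg: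
  fixes a b :: "'a::field_char_0 fps"
  assumes "a $ 0 = 1"
  shows "b * inverse a ^ m = Abs_fps (\<lambda>n. poly (s_poly b a n) (- of_nat m) / fact n)"
proof -
  let ?l = "fps_log a"
  have l0: "?l $ 0 = 0"
    by (simp add: fps_log_def)
  have "a * (fps_exp (-1) oo ?l) = (fps_exp 1 * fps_exp (-1)) oo ?l"
    by (simp only: fps_compose_mult_distrib[OF l0] fps_exp_compose_fps_log[OF assms])
  also have "\<dots> = 1"
    by (simp flip: fps_exp_add_mult)
  finally have "inverse a = fps_exp (-1) oo ?l"
    by (rule fps_inverse_unique)
  then have "inverse a ^ m = fps_exp (- of_nat m) oo ?l"
    using fps_compose_power[OF l0, of "fps_exp (-1)" m] by (simp add: fps_exp_power_mult)
  then show ?thesis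
    by (simp add: fps_compose_fps_log_gf)
qed

lemma degree_s_poly_le: "degree (s_poly b a n) \<le> n"
  unfolding s_poly_def row_poly_def
  by (intro degree_sum_le) (auto intro: order_trans[OF degree_monom_le])

text \<open>The factors -(m+n), ..., -(m+1) on the left are the negated factors of [m+1]_n. This is
  the source of the sign (-1)^n in the theorem.\<close>

lemma pochhammer_neg_reflect:
  "pochhammer (- of_nat (m + n + 1) + 1 :: 'a::comm_ring_1) n = (-1) ^ n * pochhammer (of_nat m + 1) n"
  using pochhammer_minus'[of "of_nat (m + n) :: 'a" n]
  by (simp add: algebra_simps)

lemma fps_eq_divide_one_minus_fps_X_power_iff:
  fixes f g :: "'a::field fps"
  shows "f = g / (1 - fps_X) ^ d \<longleftrightarrow> f * (1 - fps_X) ^ d = g"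
proof -
  have "((1 - fps_X) ^ d :: 'a fps) $ 0 \<noteq> 0"
    by (simp add: fps_power_zeroth)
  then have "is_unit ((1 - fps_X) ^ d :: 'a fps)"
    by (simp only: fps_is_unit_iff not_False_eq_True)
  then show ?thesis
    by (metis unit_eq_div1)
qed

theorem theorem3p2:
  fixes a b abar :: "'a::field_char_0 fps" and n :: nat
  assumes "b $ 0 \<noteq> 0"
    and "a $ 0 = 1"
    and "lt_inverse (riordan 1 (fps_X * a)) (riordan 1 (fps_X * abar))"
  shows "is_numerator_poly
           (exp_riordan ((b oo (fps_X * abar)) * fps_deriv (fps_X * abar)) (fps_X * abar)) n
           (smult ((-1) ^ n) (rev_poly n (narayana_poly b a n)))"
proof -
  let ?d = "2 * n + 1"
  let ?s = "s_poly b a n"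
  let ?g = "fps_X * abar"
  let ?M = "exp_riordan ((b oo ?g) * fps_deriv ?g) ?g"
  define p where "p = smult (inverse (fact n)) (pochhammer [:1, 1:] n * ?s)"
  have poly_p: "poly p x = pochhammer (x + 1) n * poly ?s x / fact n" for x
  proof -
    have "poly (pochhammer [:1, 1:] n) x = pochhammer (x + 1) n"
      by (simp add: pochhammer_prod poly_prod add_ac of_nat_poly)
    then show ?thesis by (simp add: p_def field_simps)
  qed
  have "degree (pochhammer [:1, 1:] n :: 'a poly) \<le> n"
  proof -
    have "degree (pochhammer [:1, 1:] n :: 'a poly) \<le> (\<Sum>i<n. degree ([:1, 1:] + of_nat i :: 'a poly))"
      unfolding pochhammer_prod by (intro order_trans[OF degree_prod_sum_le]) (auto simp: atLeast0LessThan)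
    also have "\<dots> \<le> (\<Sum>i<n. 1)"
      by (intro sum_mono degree_add_le) simp_all
    finally show ?thesis by simp
  qed
  then have "degree p \<le> 2 * n"
    using degree_s_poly_le[of b a n] degree_mult_le[of "pochhammer [:1, 1:] n" ?s]
    by (auto simp: p_def intro!: order_trans[OF degree_smult_le])
  moreover have "poly p (- of_nat i) = 0" if "1 \<le> i" "i \<le> n" for i
  proof -
    have "- of_nat i + 1 = (- of_nat (i - 1) :: 'a)"
      using that by (simp add: of_nat_diff)
    moreover have "pochhammer (- of_nat (i - 1) :: 'a) n = 0"
      using that by (intro pochhammer_of_nat_eq_0_lemma) simp
    ultimately show ?thesis by (simp add: poly_p)
  qed
  ultimately obtain h where h: "degree h \<le> n"
      "Abs_fps (\<lambda>m. poly p (of_nat m)) * (1 - fps_X) ^ ?d = fps_of_poly h"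
      "Abs_fps (\<lambda>m. poly p (- of_nat (m + n + 1))) * (1 - fps_X) ^ ?d = fps_of_poly (rev_poly n h)"
    by (rule poly_sequence_gf_reciprocity) blast
  \<comment> \<open>Existence of \<open>h\<close> comes from reciprocity, uniqueness from
    injectivity of \<open>fps_of_poly\<close>, so the definite description is justified.\<close>
  have "narayana_poly b a n = h"
    unfolding narayana_poly_def fps_eq_divide_one_minus_fps_X_power_iff poly_p[symmetric]
    by (rule the_equality) (use h in \<open>auto simp: fps_of_poly_eq_iff\<close>)
  moreover have "?M (m + n) m = (-1) ^ n * poly p (- of_nat (m + n + 1))" for m
  proof -
    have inv: "?g = fps_inv (fps_X * a)"
      using assms(3) riordan_inverse_iff[OF assms(2)] by blast
    \<comment> \<open>The power g^m is absorbed into the composed series as x^m. After inversion x^m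
      lowers the coefficient index from m+n to n, while the exponent of 1/a stays m+n+1; hence the
      argument -(m+n+1).\<close>
    have "(b oo ?g) * fps_deriv ?g * ?g ^ m = ((fps_X ^ m * b) oo ?g) * fps_deriv ?g"
      by (simp add: fps_compose_mult_distrib fps_compose_power[symmetric] mult_ac)
    then have "((b oo ?g) * fps_deriv ?g * ?g ^ m) $ (m + n)
        = (fps_X ^ m * b * inverse a ^ Suc (m + n)) $ (m + n)"
      by (simp only: lagrange_inversion_compose[OF assms(2) inv])
    also have "\<dots> = (b * inverse a ^ (m + n + 1)) $ n"
      by (simp only: mult.assoc fps_X_power_mult_nth) simp
    also have "\<dots> = poly ?s (- of_nat (m + n + 1)) / fact n"
      by (simp only: s_poly_gf_neg[OF assms(2)] fps_nth_Abs_fps)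
    finally have "((b oo ?g) * fps_deriv ?g * ?g ^ m) $ (m + n)
        = poly ?s (- of_nat (m + n + 1)) / fact n" .
    moreover have "(fact (m + n) :: 'a) = fact m * pochhammer (of_nat m + 1) n"
      by (simp add: pochhammer_fact pochhammer_product'[of 1 m n] add.commute)
    then have "(fact (m + n) / fact m :: 'a) = pochhammer (of_nat m + 1) n"
      by simp
    ultimately have "?M (m + n) m
        = pochhammer (of_nat m + 1) n * (poly ?s (- of_nat (m + n + 1)) / fact n)"
      by (simp only: exp_riordan_nth[OF le_add1])
    moreover have "(-1) ^ n * ((-1) ^ n * c) = c" for c :: 'a
      by (simp add: power_minus1_even flip: power_add mult.assoc)
    ultimately show ?thesis
      by (simp only: poly_p pochhammer_neg_reflect times_divide_eq_right mult.assoc)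
  qed
  then have "diagonal_gf ?M n = fps_const ((-1) ^ n) * Abs_fps (\<lambda>m. poly p (- of_nat (m + n + 1)))"
    by (simp add: diagonal_gf_def fps_eq_iff)
  ultimately show ?thesis
    unfolding is_numerator_poly_def fps_eq_divide_one_minus_fps_X_power_iff
    by (simp only: h(3) mult.assoc fps_of_poly_smult)
qed

end
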